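(* Let $(I,f)$, $f=f_{\mu,\pi}$, be a uniquely ergodic $d$-IET that has a piecewise continuous embedding by $h$ into a $d$-PWI $(X,T)$ with $X\subseteq\mathbb{C}$, where $T(z)=e^{i\theta_j}z+\lambda_j$ for $z\in X_j$, $j=1,\dots,d$. If there are $\xi_j\in\mathbb{C}$ such that $$\lim_{n\to+\infty}\frac{1}{m_j(p(n))}\,e_j(p(n))=\xi_j,\qquad j=1,\dots,d,$$ then $$\sum_{j=1}^{d}\left(\lambda_j-h(0)(1-e^{i\theta_j})\right)\xi_j\,\mu_j=0 .$$
   Context: IETs. Let $d\ge 2$, let $\pi$ be an irreducible permutation of $\{1,\dots,d\}$ (i.e. $\pi(\{1,\dots,k\})\ne\{1,\dots,k\}$ for $1\le k<d$), and let $\mu=(\mu_1,\dots,\mu_d)$ have positive real entries. Put $x_0=0$, $x_j=\sum_{k=1}^j\mu_k$, $I=[x_0,x_d)$, $I_j=[x_{j-1},x_j)$, and $\tau_j=\sum_{\pi(k)<\pi(j)}\mu_k-\sum_{k<j}\mu_k$. The $d$-IET $(I,f)$, $f=f_{\mu,\pi}:I\to I$, is the bijection $f(x)=x+\tau_j$ for $x\in I_j$. Uniquely ergodic means that normalized Lebesgue measure is the only $f$-invariant Borel probability measure on $I$. PWIs. A $d$-PWI $(X,T)$ consists of a set $X\subset\mathbb{C}$, a partition of $X$ into pairwise disjoint convex sets (atoms) $X_1,\dots,X_d$, and a map $T:X\to\mathbb{C}$ with $T(z)=e^{i\theta_j}z+\lambda_j$ for $z\in X_j$, where $\theta_j\in[0,2\pi)$,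 $\lambda_j\in\mathbb{C}$. (Points of $X$ may leave $X$ under $T$.) Embeddings. An injective map $h:I\to X$ is a piecewise continuous embedding of $(I,f)$ into $(X,T)$ if $h(I)$ is an invariant set for $(X,T)$, $h|_{I_j}$ is a homeomorphism onto its image and $h(I_j)\subset X_j$ for each $j$, and $h\circ f(x)=T\circ h(x)$ for all $x\in I$. Cocycles and sequences. Let $j(x)=j$ when $x\in I_j$. For $x\in I$ let $C^{(0)}(x)=0$ and $C^{(n)}(x)=\theta_{j(x)}+\theta_{j(f(x))}+\dots+\theta_{j(f^{n-1}(x))}\bmod 2\pi$ for $n\ge1$. For $x\in I_j$ let $n_j(x)=\inf\{k\ge1:f^k(x)\in I_j\}$ be the first return time to $I_j$, $f'_j(x)=f^{n_j(x)}(x)$ the first return map to $I_j$, and $N_j^{(0)}(x)=0$, $N_j^{(k)}(x)=n_j(x)+n_j(f'_j(x))+\dots+n_j((f'_j)^{k-1}(x))$ for $k\ge1$. Define $p(1)=\min\{p\ge1: f^p(0)\in I_1\}$ and, for $n>1$, $p(n)=\min\{p>p(n-1): f^p(0)<f^{p(n-1)}(0)\}$. Let $m_j(n)=\mathrm{card}\{0\le k\le n: f^k(0)\in I_j\}$, $k_j=\min\{k\ge0:f^k(0)\in I_j\}$, $x'_j=f^{k_j}(0)$, $y'_j=C^{(k_j)}(0)$, and $$c_j(n)=y'_j+C^{(N_j^{(n)}(x'_j)+1)}(x'_j),\qquad e_j(n)=\sum_{k=0}^{m_j(n)-1}\exp[-i\,c_j(k)].$$ *)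

theory Defs
  imports
    "HOL-Probability.Probability"
    "HOL-Combinatorics.Permutations"
    "HOL-Library.Real_Mod"
begin

text \<open>
  Permutations and families indexed by \<open>1, \<dots>, d\<close> are functions on \<open>nat\<close> of which only the values
  on \<open>{1..d}\<close> matter.
\<close>

section \<open>Interval exchange transformations\<close>

definition irreducible_perm :: "nat \<Rightarrow> (nat \<Rightarrow> nat) \<Rightarrow> bool" where
  "irreducible_perm d \<pi> \<longleftrightarrow>
     \<pi> permutes {1..d} \<and> (\<forall>k. 1 \<le> k \<and> k < d \<longrightarrow> \<pi> ` {1..k} \<noteq> {1..k})"

definition iet_data :: "nat \<Rightarrow> (nat \<Rightarrow> real) \<Rightarrow> (nat \<Rightarrow> nat) \<Rightarrow> bool" where
  "iet_data d \<mu> \<pi> \<longleftrightarrow> 2 \<le> d \<and> irreducible_perm d \<pi> \<and> (\<forall>j\<in>{1..d}. 0 < \<mu> j)"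

definition iet_pt :: "(nat \<Rightarrow> real) \<Rightarrow> nat \<Rightarrow> real" where
  "iet_pt \<mu> j = (\<Sum>k=1..j. \<mu> k)"

definition iet_dom :: "nat \<Rightarrow> (nat \<Rightarrow> real) \<Rightarrow> real set" where
  "iet_dom d \<mu> = {iet_pt \<mu> 0..<iet_pt \<mu> d}"

definition iet_int :: "(nat \<Rightarrow> real) \<Rightarrow> nat \<Rightarrow> real set" where
  "iet_int \<mu> j = {iet_pt \<mu> (j - 1)..<iet_pt \<mu> j}"

definition iet_idx :: "nat \<Rightarrow> (nat \<Rightarrow> real) \<Rightarrow> real \<Rightarrow> nat" where
  "iet_idx d \<mu> x = (THE j. j \<in> {1..d} \<and> x \<in> iet_int \<mu> j)"

definition iet_transl :: "nat \<Rightarrow> (nat \<Rightarrow> real) \<Rightarrow> (nat \<Rightarrow> nat) \<Rightarrow> nat \<Rightarrow> real" where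
  "iet_transl d \<mu> \<pi> j = (\<Sum>k | k \<in> {1..d} \<and> \<pi> k < \<pi> j. \<mu> k) - (\<Sum>k\<in>{1..<j}. \<mu> k)"

text \<open>Meaningful only on \<^term>\<open>iet_dom d \<mu>\<close>, which it maps bijectively onto itself.\<close>

definition iet :: "nat \<Rightarrow> (nat \<Rightarrow> real) \<Rightarrow> (nat \<Rightarrow> nat) \<Rightarrow> real \<Rightarrow> real" where
  "iet d \<mu> \<pi> x = x + iet_transl d \<mu> \<pi> (iet_idx d \<mu> x)"

definition invariant_borel_probs :: "real set \<Rightarrow> (real \<Rightarrow> real) \<Rightarrow> real measure set" where
  "invariant_borel_probs I f =
     {M. sets M = sets (restrict_space borel I) \<and> prob_space M \<and>
         f \<in> measurable M M \<and> distr M M f = M}"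

definition uniquely_ergodic_iet :: "nat \<Rightarrow> (nat \<Rightarrow> real) \<Rightarrow> (nat \<Rightarrow> nat) \<Rightarrow> bool" where
  "uniquely_ergodic_iet d \<mu> \<pi> \<longleftrightarrow>
     invariant_borel_probs (iet_dom d \<mu>) (iet d \<mu> \<pi>) =
       {uniform_measure (restrict_space lborel (iet_dom d \<mu>)) (iet_dom d \<mu>)}"

section \<open>Piecewise isometries and embeddings\<close>

text \<open>\<^term>\<open>T\<close> need not map \<^term>\<open>X\<close> into itself; its values outside \<^term>\<open>X\<close> are irrelevant.\<close>

definition pwi ::
  "nat \<Rightarrow> complex set \<Rightarrow> (nat \<Rightarrow> complex set) \<Rightarrow> (nat \<Rightarrow> real) \<Rightarrow> (nat \<Rightarrow> complex) \<Rightarrow>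
   (complex \<Rightarrow> complex) \<Rightarrow> bool" where
  "pwi d X Xs \<theta> l T \<longleftrightarrow>
     (\<Union>j\<in>{1..d}. Xs j) = X \<and> disjoint_family_on Xs {1..d} \<and>
     (\<forall>j\<in>{1..d}. Xs j \<noteq> {} \<and> convex (Xs j) \<and> \<theta> j \<in> {0..<2 * pi} \<and>
        (\<forall>z\<in>Xs j. T z = exp (\<i> * of_real (\<theta> j)) * z + l j))"

text \<open>
  Invariance of the image is stated as forward invariance; equality then follows from the
  intertwining relation and the surjectivity of the interval exchange on its domain.
\<close>

definition pw_cont_embedding ::
  "nat \<Rightarrow> (nat \<Rightarrow> real) \<Rightarrow> (nat \<Rightarrow> nat) \<Rightarrow> complex set \<Rightarrow> (nat \<Rightarrow> complex set) \<Rightarrow>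
   (complex \<Rightarrow> complex) \<Rightarrow> (real \<Rightarrow> complex) \<Rightarrow> bool" where
  "pw_cont_embedding d \<mu> \<pi> X Xs T h \<longleftrightarrow>
     inj_on h (iet_dom d \<mu>) \<and> h ` iet_dom d \<mu> \<subseteq> X \<and>
     T ` h ` iet_dom d \<mu> \<subseteq> h ` iet_dom d \<mu> \<and>
     (\<forall>j\<in>{1..d}. (\<exists>g. homeomorphism (iet_int \<mu> j) (h ` iet_int \<mu> j) h g) \<and>
        h ` iet_int \<mu> j \<subseteq> Xs j) \<and>
     (\<forall>x\<in>iet_dom d \<mu>. h (iet d \<mu> \<pi> x) = T (h x))"

section \<open>Cocycles and sequences\<close>

text \<open>Angles modulo \<open>2\<pi>\<close> are represented in \<open>[0, 2\<pi>)\<close>.\<close>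

definition cocycle ::
  "nat \<Rightarrow> (nat \<Rightarrow> real) \<Rightarrow> (nat \<Rightarrow> nat) \<Rightarrow> (nat \<Rightarrow> real) \<Rightarrow> nat \<Rightarrow> real \<Rightarrow> real" where
  "cocycle d \<mu> \<pi> \<theta> n x = (\<Sum>i<n. \<theta> (iet_idx d \<mu> ((iet d \<mu> \<pi> ^^ i) x))) rmod (2 * pi)"

text \<open>
  All the minima below are over nonempty sets when the interval exchange is uniquely ergodic:
  it is then minimal and has no periodic points.
\<close>

definition ret_time :: "nat \<Rightarrow> (nat \<Rightarrow> real) \<Rightarrow> (nat \<Rightarrow> nat) \<Rightarrow> nat \<Rightarrow> real \<Rightarrow> nat" where
  "ret_time d \<mu> \<pi> j x = (LEAST k. 1 \<le> k \<and> (iet d \<mu> \<pi> ^^ k) x \<in> iet_int \<mu> j)"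

definition ret_map :: "nat \<Rightarrow> (nat \<Rightarrow> real) \<Rightarrow> (nat \<Rightarrow> nat) \<Rightarrow> nat \<Rightarrow> real \<Rightarrow> real" where
  "ret_map d \<mu> \<pi> j x = (iet d \<mu> \<pi> ^^ ret_time d \<mu> \<pi> j x) x"

definition ret_time_sum ::
  "nat \<Rightarrow> (nat \<Rightarrow> real) \<Rightarrow> (nat \<Rightarrow> nat) \<Rightarrow> nat \<Rightarrow> nat \<Rightarrow> real \<Rightarrow> nat" where
  "ret_time_sum d \<mu> \<pi> j k x = (\<Sum>i<k. ret_time d \<mu> \<pi> j ((ret_map d \<mu> \<pi> j ^^ i) x))"

text \<open>The sequence \<open>p(n)\<close> of closest returns of the orbit of \<open>0\<close>; it starts at \<open>n = 1\<close>, and the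
  value at \<open>n = 0\<close> is a dummy.\<close>

fun closest_ret :: "nat \<Rightarrow> (nat \<Rightarrow> real) \<Rightarrow> (nat \<Rightarrow> nat) \<Rightarrow> nat \<Rightarrow> nat" where
  "closest_ret d \<mu> \<pi> 0 = 0"
| "closest_ret d \<mu> \<pi> (Suc 0) = (LEAST p. 1 \<le> p \<and> (iet d \<mu> \<pi> ^^ p) 0 \<in> iet_int \<mu> 1)"
| "closest_ret d \<mu> \<pi> (Suc (Suc n)) =
     (LEAST p. closest_ret d \<mu> \<pi> (Suc n) < p \<and>
        (iet d \<mu> \<pi> ^^ p) 0 < (iet d \<mu> \<pi> ^^ closest_ret d \<mu> \<pi> (Suc n)) 0)"

definition visits :: "nat \<Rightarrow> (nat \<Rightarrow> real) \<Rightarrow> (nat \<Rightarrow> nat) \<Rightarrow> nat \<Rightarrow> nat \<Rightarrow> nat" where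
  "visits d \<mu> \<pi> j n = card {k. k \<le> n \<and> (iet d \<mu> \<pi> ^^ k) 0 \<in> iet_int \<mu> j}"

definition entry_time :: "nat \<Rightarrow> (nat \<Rightarrow> real) \<Rightarrow> (nat \<Rightarrow> nat) \<Rightarrow> nat \<Rightarrow> nat" where
  "entry_time d \<mu> \<pi> j = (LEAST k. (iet d \<mu> \<pi> ^^ k) 0 \<in> iet_int \<mu> j)"

definition entry_pt :: "nat \<Rightarrow> (nat \<Rightarrow> real) \<Rightarrow> (nat \<Rightarrow> nat) \<Rightarrow> nat \<Rightarrow> real" where
  "entry_pt d \<mu> \<pi> j = (iet d \<mu> \<pi> ^^ entry_time d \<mu> \<pi> j) 0"

text \<open>The quantities \<open>c\<^sub>j(n)\<close> and \<open>e\<^sub>j(n)\<close>.\<close>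

definition visit_angle ::
  "nat \<Rightarrow> (nat \<Rightarrow> real) \<Rightarrow> (nat \<Rightarrow> nat) \<Rightarrow> (nat \<Rightarrow> real) \<Rightarrow> nat \<Rightarrow> nat \<Rightarrow> real" where
  "visit_angle d \<mu> \<pi> \<theta> j n =
     cocycle d \<mu> \<pi> \<theta> (entry_time d \<mu> \<pi> j) 0 +
     cocycle d \<mu> \<pi> \<theta> (ret_time_sum d \<mu> \<pi> j n (entry_pt d \<mu> \<pi> j) + 1) (entry_pt d \<mu> \<pi> j)"

definition visit_exp_sum ::
  "nat \<Rightarrow> (nat \<Rightarrow> real) \<Rightarrow> (nat \<Rightarrow> nat) \<Rightarrow> (nat \<Rightarrow> real) \<Rightarrow> nat \<Rightarrow> nat \<Rightarrow> complex" where
  "visit_exp_sum d \<mu> \<pi> \<theta> j n =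
     (\<Sum>k<visits d \<mu> \<pi> j n. exp (- \<i> * of_real (visit_angle d \<mu> \<pi> \<theta> j k)))"

end

theory Submission
  imports Defs
begin

text \<open>
  Let \<open>z\<^sub>k\<close> be the image under \<open>h\<close> of the \<open>k\<close>-th point of the orbit of \<open>0\<close>. Along this orbit the
  piecewise isometry acts by \<open>z\<^sub>k\<^sub>+\<^sub>1 = exp (i \<phi>) z\<^sub>k + b\<close>, with the angle \<open>\<phi>\<close> and the translation \<open>b\<close> of the
  interval that contains the \<open>k\<close>-th orbit point. Undoing the accumulated rotation turns the
  recurrence into a telescoping sum (\<open>rotated_recurrence_telescope\<close>): up to a factor of modulus one,
  \<open>z\<^sub>n\<^sub>+\<^sub>1 - z\<^sub>0\<close> is the sum over \<open>k \<le> n\<close> of \<open>A\<^sub>j = \<lambda>\<^sub>j - h(0) (1 - exp (i \<theta>\<^sub>j))\<close> times the exponential of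
  minus the angle accumulated up to time \<open>k + 1\<close>, where \<open>j\<close> is the interval visited at time \<open>k\<close>.
  Collecting the times of visit to each interval gives \<open>\<Sum>\<^sub>j A\<^sub>j e\<^sub>j(n)\<close>, because the return times to
  the \<open>j\<close>-th interval enumerate precisely these times (\<open>visit_exp_sum_eq\<close>).

  Divide by \<open>n + 1\<close> and let \<open>n\<close> run through the closest returns \<open>p(n)\<close>. At these times the orbit stays
  in a compact part of the first interval, where \<open>h\<close> is continuous, so \<open>z\<^sub>n\<^sub>+\<^sub>1\<close> remains bounded and
  the left-hand side tends to \<open>0\<close>. (The map \<open>h\<close> may be unbounded at the right ends of the intervals;
  this is why one passes to closest returns.) On the right-hand side \<open>e\<^sub>j/(n+1)\<close> is
  \<open>e\<^sub>j/m\<^sub>j\<close>, which tends to \<open>\<xi>\<^sub>j\<close>, times the visit frequency \<open>m\<^sub>j/(n+1)\<close>, which tends to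
  \<open>\<mu>\<^sub>j/L\<close>, where \<open>L\<close> is the length of the domain.

  What remains is that the orbit of \<open>0\<close> is equidistributed (\<open>orbit_equidistributed\<close>). Weak limits of its
  empirical measures exist by Helly's theorem, but the exchange is discontinuous and its domain is
  not compact, so a limit is known to be invariant and carried by the domain once it has no atoms at
  the endpoints. It has no atoms at all: an atomic measure on a periodic orbit would be a second
  invariant measure, so there are no periodic points; hence a sufficiently short one-sided
  neighbourhood of a point has many pairwise disjoint iterates, which are visited
  about equally often, and so it is visited rarely (\<open>one_sided_few_visits\<close>).
\<close>

section \<open>Empirical measures and their weak limits\<close>

definition empirical :: "(nat \<Rightarrow> real) \<Rightarrow> nat \<Rightarrow> real measure" where
  "empirical x n = distr (measure_pmf (pmf_of_set {..n})) borel x"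

lemma real_distribution_empirical: "real_distribution (empirical x n)"
  unfolding empirical_def by (intro prob_space.real_distribution_distr) (simp_all add: prob_space_measure_pmf)

lemma measure_empirical:
  assumes "A \<in> sets borel"
  shows "measure (empirical x n) A = real (card {k. k \<le> n \<and> x k \<in> A}) / real (Suc n)"
proof -
  have "{..n} \<inter> x -` A = {k. k \<le> n \<and> x k \<in> A}" by auto
  then show ?thesis
    using assms unfolding empirical_def
    by (subst measure_distr) (simp_all add: measure_pmf_of_set)
qed

lemma integral_empirical:
  fixes g :: "real \<Rightarrow> real"
  assumes "g \<in> borel_measurable borel"
  shows "(\<integral>y. g y \<partial>empirical x n) = (\<Sum>k\<le>n. g (x k)) / real (Suc n)"
  using assms unfolding empirical_def
  by (subst integral_distr) (simp_all add: integral_pmf_of_set)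

lemma tight_empirical:
  assumes "\<And>k. x k \<in> {a..b}"
  shows "tight (empirical x)"
  unfolding tight_def
proof (intro conjI allI impI)
  fix e :: real assume "e > 0"
  have "measure (empirical x n) {a - 1<..b + 1} = 1" for n
  proof -
    have "{k. k \<le> n \<and> x k \<in> {a - 1<..b + 1}} = {..n}"
    proof (intro equalityI subsetI)
      fix k assume "k \<in> {..n}"
      then show "k \<in> {k. k \<le> n \<and> x k \<in> {a - 1<..b + 1}}" using assms[of k] by auto
    qed auto
    then show ?thesis by (subst measure_empirical) auto
  qed
  moreover have "a - 1 < b + 1" using assms[of 0] by auto
  ultimately show "\<exists>a b. a < b \<and> (\<forall>n. 1 - e < measure (empirical x n) {a<..b})"
    using \<open>e > 0\<close> by (intro exI[of _ "a - 1"] exI[of _ "b + 1"]) auto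
qed (rule real_distribution_empirical)

text \<open>
  Weak convergence controls the mass of an interval whose endpoints are not atoms of the limit. As
  there are only countably many atoms, such intervals exist inside every neighbourhood of \<open>y\<close>.
\<close>

lemma weak_limit_atomless:
  fixes N :: "nat \<Rightarrow> real measure"
  assumes N: "\<And>n. real_distribution (N n)" and M: "real_distribution M" and conv: "weak_conv_m N M"
    and small: "\<And>e. e > 0 \<Longrightarrow> \<exists>U. open U \<and> y \<in> U \<and> (\<forall>\<^sub>F n in sequentially. measure (N n) U \<le> e)"
  shows "measure M {y} = 0"
proof -
  interpret M: real_distribution M by fact
  have "measure M {y} \<le> e" if e: "e > 0" for e
  proof -
    from small[OF e] obtain U where U: "open U" "y \<in> U" "\<forall>\<^sub>F n in sequentially. measure (N n) U \<le> e"
      by blast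
    obtain r where r: "r > 0" "ball y r \<subseteq> U"
      using U(1,2) by (auto simp: open_contains_ball)
    obtain a where a: "a \<in> {y - r<..<y}" "\<not> measure M {a} > 0"
      using open_minus_countable[OF M.countable_atoms, of "{y - r<..<y}"] r by auto
    obtain b where b: "b \<in> {y<..<y + r}" "\<not> measure M {b} > 0"
      using open_minus_countable[OF M.countable_atoms, of "{y<..<y + r}"] r by auto
    have ab0: "emeasure M {a} = 0" "emeasure M {b} = 0"
      using a(2) b(2) by (simp_all add: zero_less_measure_iff M.emeasure_eq_measure)
    have "{a} \<union> {b} \<in> null_sets M"
      using ab0 by (intro null_sets.Un) (simp_all add: null_sets_def)
    moreover have "frontier {a<..<b} = {a} \<union> {b}" using a b by (auto simp: frontier_def)
    ultimately have "M (frontier {a<..<b}) = 0" by (simp add: null_sets_def)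
    then have "(\<lambda>n. measure (N n) {a<..<b}) \<longlonglongrightarrow> measure M {a<..<b}"
      by (intro weak_conv_imp_continuity_set_conv[OF N M conv]) auto
    moreover have "\<forall>\<^sub>F n in sequentially. measure (N n) {a<..<b} \<le> e"
      using U(3)
    proof eventually_elim
      fix n assume *: "measure (N n) U \<le> e"
      interpret Nn: real_distribution "N n" by fact
      have "{a<..<b} \<subseteq> U" using a b r by (auto simp: dist_real_def subset_iff)
      then have "measure (N n) {a<..<b} \<le> measure (N n) U"
        using U(1) by (intro Nn.finite_measure_mono) auto
      with * show "measure (N n) {a<..<b} \<le> e" by simp
    qed
    ultimately have "measure M {a<..<b} \<le> e"
      by (rule tendsto_upperbound) simp
    moreover have "measure M {y} \<le> measure M {a<..<b}"
      using a b by (intro M.finite_measure_mono) auto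
    ultimately show ?thesis by simp
  qed
  then have "measure M {y} \<le> 0" by (rule field_le_epsilon) simp
  then show ?thesis by (simp add: measure_le_0_iff)
qed

text \<open>
  The averages of \<open>g \<circ> F\<close> and of \<open>g\<close> along an orbit of \<open>F\<close> differ by a boundary term
  \<open>(g (x (Suc n)) - g (x 0)) / (n + 1)\<close>. An atomless limit does not see the countably many
  discontinuities of \<open>F\<close>, so both averages pass to the limit.
\<close>

lemma weak_limit_invariant:
  fixes F :: "real \<Rightarrow> real"
  assumes step: "\<And>k. x (Suc k) = F (x k)"
    and F[measurable]: "F \<in> borel_measurable borel"
    and cnt: "countable {y. \<not> isCont F y}"
    and s: "strict_mono s" and M: "real_distribution M" and conv: "weak_conv_m (empirical x \<circ> s) M"
    and atomless: "\<And>y. measure M {y} = 0"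
  shows "distr M borel F = M"
proof -
  interpret M: real_distribution M by fact
  let ?N = "empirical x \<circ> s"
  have N: "real_distribution (?N n)" for n by (simp add: real_distribution_empirical)
  have dM: "real_distribution (distr M borel F)"
    by (intro M.real_distribution_distr) simp
  have null: "M A = 0" if "countable A" for A
  proof -
    have "(\<Union>y\<in>A. {y}) \<in> null_sets M"
      using atomless by (intro null_sets_UN' that) (simp add: null_sets_def M.emeasure_eq_measure)
    then show ?thesis by (simp add: null_sets_def)
  qed
  have "weak_conv_m (\<lambda>_::nat. distr M borel F) M"
  proof (rule integral_bdd_continuous_conv_imp_weak_conv[OF dM M])
    fix g :: "real \<Rightarrow> real"
    assume g: "\<And>y. isCont g y" "\<And>y. \<bar>g y\<bar> \<le> 1"
    have [measurable]: "g \<in> borel_measurable borel"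
      using g by (intro borel_measurable_continuous_onI continuous_at_imp_continuous_on) auto
    have "{y. \<not> isCont (\<lambda>y. g (F y)) y} \<subseteq> {y. \<not> isCont F y}"
      using isCont_o2[where f = F and g = g] g(1) by blast
    then have "M {y. \<not> isCont (\<lambda>y. g (F y)) y} = 0"
      by (intro null countable_subset[OF _ cnt])
    then have "(\<lambda>n. \<integral>y. g (F y) \<partial>?N n) \<longlonglongrightarrow> (\<integral>y. g (F y) \<partial>M)"
      by (rule weak_conv_imp_bdd_ae_continuous_conv[OF N M conv]) (use g in auto)
    moreover have "(\<lambda>n. \<integral>y. g y \<partial>?N n) \<longlonglongrightarrow> (\<integral>y. g y \<partial>M)"
      by (rule weak_conv_imp_integral_bdd_continuous_conv[OF N M conv]) (use g in auto)
    ultimately have *: "(\<lambda>n. (\<integral>y. g (F y) \<partial>?N n) - (\<integral>y. g y \<partial>?N n)) \<longlonglongrightarrow>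
        (\<integral>y. g (F y) \<partial>M) - (\<integral>y. g y \<partial>M)"
      by (rule tendsto_diff)
    have "(\<lambda>n. (\<integral>y. g (F y) \<partial>?N n) - (\<integral>y. g y \<partial>?N n)) \<longlonglongrightarrow> 0"
    proof (rule Lim_null_comparison)
      have "(\<lambda>n. 2 / real (Suc n)) \<longlonglongrightarrow> 0" using lim_const_over_n[THEN LIMSEQ_Suc, of 2] by simp
      from LIMSEQ_subseq_LIMSEQ[OF this s] show "(\<lambda>n. 2 / real (Suc (s n))) \<longlonglongrightarrow> 0"
        by (simp add: o_def)
      have "norm ((\<integral>y. g (F y) \<partial>?N n) - (\<integral>y. g y \<partial>?N n)) \<le> 2 / real (Suc (s n))" for n
      proof -
        have tel: "(\<Sum>k\<le>m. g (F (x k))) - (\<Sum>k\<le>m. g (x k)) = g (x (Suc m)) - g (x 0)" for m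
          by (induction m) (auto simp: step)
        have "(\<integral>y. g (F y) \<partial>?N n) - (\<integral>y. g y \<partial>?N n) = (g (x (Suc (s n))) - g (x 0)) / real (Suc (s n))"
          by (simp add: integral_empirical tel flip: diff_divide_distrib)
        moreover have "\<bar>g (x (Suc (s n))) - g (x 0)\<bar> \<le> 2"
          using g(2)[of "x (Suc (s n))"] g(2)[of "x 0"] by linarith
        ultimately show ?thesis by (simp add: divide_right_mono)
      qed
      then show "\<forall>\<^sub>F n in sequentially. norm ((\<integral>y. g (F y) \<partial>?N n) - (\<integral>y. g y \<partial>?N n)) \<le> 2 / real (Suc (s n))"
        by simp
    qed
    then have "(\<integral>y. g (F y) \<partial>M) = (\<integral>y. g y \<partial>M)"
      using LIMSEQ_unique[OF *] by force
    then show "(\<lambda>n. \<integral>y. g y \<partial>distr M borel F) \<longlonglongrightarrow> (\<integral>y. g y \<partial>M)"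
      by (simp add: integral_distr)
  qed
  then have "cdf (distr M borel F) y = cdf M y" for y
    using atomless[of y] unfolding weak_conv_m_def weak_conv_def M.isCont_cdf by (simp add: LIMSEQ_const_iff)
  then show ?thesis by (intro cdf_unique dM M ext)
qed

text \<open>
  A visit to \<open>U\<close> at time \<open>k\<close> yields visits to the \<open>N\<close> disjoint iterates of \<open>U\<close> at the times
  \<open>k, \<dots>, k + N - 1\<close>; disjointness makes the pairs \<open>(i, k)\<close> recoverable from the time \<open>i + k\<close>.
\<close>

lemma card_visits_disjoint_iterates:
  fixes f :: "'a \<Rightarrow> 'a"
  assumes "\<And>i i' z z'. i < N \<Longrightarrow> i' < N \<Longrightarrow> i \<noteq> i' \<Longrightarrow> z \<in> U \<Longrightarrow> z' \<in> U \<Longrightarrow> (f ^^ i) z \<noteq> (f ^^ i') z'"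
  shows "N * card {k. k \<le> n \<and> (f ^^ k) x \<in> U} \<le> n + 1 + N"
proof -
  let ?V = "{k. k \<le> n \<and> (f ^^ k) x \<in> U}"
  have "inj_on (\<lambda>(i, k). i + k) ({..<N} \<times> ?V)"
  proof (rule inj_onI, clarify)
    fix i k i' k'
    assume *: "i < N" "i' < N" "i + k = i' + k'" "(f ^^ k) x \<in> U" "(f ^^ k') x \<in> U"
    have "(f ^^ i) ((f ^^ k) x) = (f ^^ i') ((f ^^ k') x)"
      using *(3) by (metis comp_apply funpow_add)
    with assms[of i i'] * have "i = i'" by blast
    with * show "i = i' \<and> k = k'" by simp
  qed
  moreover have "(\<lambda>(i, k). i + k) ` ({..<N} \<times> ?V) \<subseteq> {..<n + 1 + N}" by auto
  ultimately have "card ({..<N} \<times> ?V) \<le> card {..<n + 1 + N}"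
    by (intro card_inj_on_le) auto
  then show ?thesis by (simp add: card_cartesian_product)
qed

section \<open>Interval exchanges and their one-sided local behaviour\<close>

locale interval_exchange =
  fixes d :: nat and \<mu> :: "nat \<Rightarrow> real" and \<pi> :: "nat \<Rightarrow> nat"
  assumes data: "iet_data d \<mu> \<pi>"
begin

abbreviation "I \<equiv> iet_dom d \<mu>"
abbreviation "J \<equiv> iet_int \<mu>"
abbreviation "L \<equiv> iet_pt \<mu> d"
abbreviation "f \<equiv> iet d \<mu> \<pi>"
abbreviation "\<tau> \<equiv> iet_transl d \<mu> \<pi>"
abbreviation "ix \<equiv> iet_idx d \<mu>"

lemma d_ge_2: "2 \<le> d" and pos: "j \<in> {1..d} \<Longrightarrow> 0 < \<mu> j"
  using data by (auto simp: iet_data_def irreducible_perm_def)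

lemma iet_pt_0 [simp]: "iet_pt \<mu> 0 = 0" by (simp add: iet_pt_def)

lemma iet_pt_diff: "j \<in> {1..d} \<Longrightarrow> iet_pt \<mu> j = iet_pt \<mu> (j - 1) + \<mu> j"
  by (cases j) (auto simp: iet_pt_def)

lemma iet_pt_mono: "i \<le> j \<Longrightarrow> j \<le> d \<Longrightarrow> iet_pt \<mu> i \<le> iet_pt \<mu> j"
  unfolding iet_pt_def by (intro sum_mono2) (auto intro!: less_imp_le pos)

lemma L_pos: "0 < L"
  using iet_pt_mono[of 1 d] iet_pt_diff[of 1] pos[of 1] d_ge_2 by simp

lemma dom_eq: "I = {0..<L}" by (simp add: iet_dom_def)

lemma zero_in_dom: "0 \<in> I" using L_pos by (simp add: dom_eq)

lemma int_subset_dom: "j \<in> {1..d} \<Longrightarrow> J j \<subseteq> I"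
proof -
  assume "j \<in> {1..d}"
  then have "0 \<le> iet_pt \<mu> (j - 1)" "iet_pt \<mu> j \<le> L"
    using iet_pt_mono[of 0 "j - 1"] iet_pt_mono[of j d] by auto
  then show ?thesis by (auto simp: iet_int_def dom_eq)
qed

lemma int_disjoint:
  assumes "i \<in> {1..d}" "j \<in> {1..d}" "x \<in> J i" "x \<in> J j"
  shows "i = j"
proof (rule ccontr)
  assume "i \<noteq> j"
  then consider "i \<le> j - 1" "j - 1 \<le> d" | "j \<le> i - 1" "i - 1 \<le> d"
    using assms(1,2) by (auto simp: le_diff_conv) linarith
  then have "iet_pt \<mu> i \<le> iet_pt \<mu> (j - 1) \<or> iet_pt \<mu> j \<le> iet_pt \<mu> (i - 1)"
    by cases (auto intro: iet_pt_mono)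
  then show False using assms(3,4) by (auto simp: iet_int_def)
qed

lemma dom_UN_int: "I = (\<Union>j\<in>{1..d}. J j)"
proof
  show "I \<subseteq> (\<Union>j\<in>{1..d}. J j)"
  proof
    fix x assume x: "x \<in> I"
    define j where "j = (LEAST j. x < iet_pt \<mu> j)"
    have "x < iet_pt \<mu> d" using x by (simp add: dom_eq)
    then have j: "x < iet_pt \<mu> j" "j \<le> d" unfolding j_def by (auto intro: LeastI Least_le)
    have "j \<noteq> 0" using j x by (intro notI) (simp add: dom_eq)
    moreover have "iet_pt \<mu> (j - 1) \<le> x"
      using not_less_Least[of "j - 1" "\<lambda>j. x < iet_pt \<mu> j"] \<open>j \<noteq> 0\<close> by (simp flip: j_def)
    ultimately show "x \<in> (\<Union>j\<in>{1..d}. J j)" using j by (auto simp: iet_int_def)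
  qed
qed (use int_subset_dom in blast)

lemma idx_eq: "j \<in> {1..d} \<Longrightarrow> x \<in> J j \<Longrightarrow> ix x = j"
  unfolding iet_idx_def using int_disjoint by (intro the_equality) blast+

lemma
  assumes "x \<in> I"
  shows idx_in: "ix x \<in> {1..d}" and in_int_idx: "x \<in> J (ix x)"
proof -
  obtain j where "j \<in> {1..d}" "x \<in> J j" using assms unfolding dom_UN_int by blast
  with idx_eq[OF this] show "ix x \<in> {1..d}" "x \<in> J (ix x)" by simp_all
qed

lemma iet_eq: "j \<in> {1..d} \<Longrightarrow> x \<in> J j \<Longrightarrow> f x = x + \<tau> j"
  by (simp add: iet_def idx_eq)

text \<open>
  The image of the \<open>j\<close>-th interval starts at the total length of the intervals placed before it; these
  and the \<open>j\<close>-th one are distinct intervals of the domain, so it ends at \<open>L\<close> or before.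
\<close>

lemma iet_in_dom:
  assumes "x \<in> I"
  shows "f x \<in> I"
proof -
  define j where "j = ix x"
  have j: "j \<in> {1..d}" "x \<in> J j" using idx_in[OF assms] in_int_idx[OF assms] unfolding j_def by blast+
  let ?P = "{k \<in> {1..d}. \<pi> k < \<pi> j}"
  have fx: "f x = (x - iet_pt \<mu> (j - 1)) + sum \<mu> ?P"
    using j by (simp add: iet_eq iet_transl_def iet_pt_def atLeastLessThanSuc_atLeastAtMost[symmetric])
  have x: "0 \<le> x - iet_pt \<mu> (j - 1)" "x - iet_pt \<mu> (j - 1) < \<mu> j"
    using j iet_pt_diff[of j] by (auto simp: iet_int_def)
  have "sum \<mu> ?P \<ge> 0" by (intro sum_nonneg less_imp_le pos) simp
  moreover have "sum \<mu> ?P + \<mu> j = sum \<mu> (insert j ?P)" by simp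
  moreover have "sum \<mu> (insert j ?P) \<le> L"
    unfolding iet_pt_def
  proof (rule sum_mono2)
    show "insert j ?P \<subseteq> {1..d}" using j by auto
  qed (auto intro: less_imp_le[OF pos])
  ultimately show ?thesis using fx x by (auto simp: dom_eq)
qed

lemma funpow_iet_in_dom: "x \<in> I \<Longrightarrow> (f ^^ n) x \<in> I"
  by (induction n) (auto intro: iet_in_dom)

text \<open>
  The exchange extended to the whole line by the identity. Outside its domain \<^const>\<open>iet\<close> applies
  the translation of an unspecified index, which says nothing about measurability or continuity.
\<close>

definition iet_total :: "real \<Rightarrow> real" where
  "iet_total x = x + (\<Sum>j=1..d. \<tau> j * indicator (J j) x)"

lemma iet_total_eq: "x \<in> I \<Longrightarrow> iet_total x = f x"
proof -
  assume x: "x \<in> I"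
  have "\<tau> j * indicator (J j) x = (if j = ix x then \<tau> j else 0)" if "j \<in> {1..d}" for j
  proof -
    have "x \<in> J j \<longleftrightarrow> j = ix x" using idx_eq[OF that, of x] in_int_idx[OF x] by blast
    then show ?thesis by (simp only: indicator_def mult_1_right mult_zero_right split: if_split) simp
  qed
  then have "(\<Sum>j=1..d. \<tau> j * indicator (J j) x) = (\<Sum>j\<in>{1..d}. if j = ix x then \<tau> j else 0)"
    by (rule sum.cong[OF refl])
  then show ?thesis using x idx_in[of x] by (simp add: iet_total_def iet_def)
qed

lemma iet_total_measurable [measurable]: "iet_total \<in> borel_measurable borel"
  unfolding iet_total_def[abs_def] iet_int_def by measurable

lemma countable_discont_iet_total: "countable {x. \<not> isCont iet_total x}"
proof (rule countable_subset)
  let ?E = "\<Union>j\<in>{1..d}. {iet_pt \<mu> (j - 1), iet_pt \<mu> j}"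
  show "countable ?E" by simp
  have "isCont iet_total x" if "x \<notin> ?E" for x
    unfolding iet_total_def[abs_def]
  proof (intro continuous_intros)
    fix j assume j: "j \<in> {1..d}"
    then have "iet_pt \<mu> (j - 1) < iet_pt \<mu> j" using iet_pt_diff pos by simp
    then have "frontier (J j) = {iet_pt \<mu> (j - 1), iet_pt \<mu> j}"
      by (auto simp: iet_int_def frontier_def interior_atLeastLessThan closure_atLeastLessThan)
    then have "x \<notin> frontier (J j)" using that j by blast
    then show "isCont (indicator (J j) :: real \<Rightarrow> real) x" by (simp add: isCont_indicator)
  qed
  then show "{x. \<not> isCont iet_total x} \<subseteq> ?E" by blast
qed

lemma iet_measurable: "f \<in> measurable (restrict_space borel I) (restrict_space borel I)"
proof (rule measurable_restrict_space2)
  have "iet_total \<in> borel_measurable (restrict_space borel I)" by (intro measurable_restrict_space1) simp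
  then show "f \<in> borel_measurable (restrict_space borel I)"
    by (subst measurable_cong[of _ _ iet_total]) (simp_all add: space_restrict_space iet_total_eq)
qed (auto simp: space_restrict_space iet_in_dom)

end

text \<open>
  Discontinuities are an obstacle only for two-sided neighbourhoods: close to \<open>y\<close> on one given side,
  the exchange is given by a single formula.
\<close>

lemma one_sided_interval_dichotomy:
  fixes a b y :: real
  assumes "G = at_left y \<or> G = at_right y"
  shows "(\<forall>\<^sub>F z in G. z \<in> {a..<b}) \<or> (\<forall>\<^sub>F z in G. z \<notin> {a..<b})"
  using assms
proof
  assume G: "G = at_left y"
  consider "y \<le> a" | "a < y" "y \<le> b" | "b < y" by linarith
  then show ?thesis
  proof cases
    case 1
    then show ?thesis unfolding G by (auto simp: eventually_at_left_field intro!: exI[of _ "y - 1"])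
  next
    case 2
    then show ?thesis unfolding G by (auto simp: eventually_at_left_field intro!: exI[of _ a])
  next
    case 3
    then show ?thesis unfolding G by (auto simp: eventually_at_left_field intro!: exI[of _ b])
  qed
next
  assume G: "G = at_right y"
  consider "y < a" | "a \<le> y" "y < b" | "b \<le> y" by linarith
  then show ?thesis
  proof cases
    case 1
    then show ?thesis unfolding G by (auto simp: eventually_at_right_field intro!: exI[of _ a])
  next
    case 2
    then show ?thesis unfolding G by (auto simp: eventually_at_right_field intro!: exI[of _ b])
  next
    case 3
    then show ?thesis unfolding G by (auto simp: eventually_at_right_field intro!: exI[of _ "y + 1"])
  qed
qed

context interval_exchange
begin

lemma one_sided_in_int:
  assumes G: "G = at_left y \<or> G = at_right y" and "\<forall>\<^sub>F z in G. z \<in> I"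
  shows "\<exists>j\<in>{1..d}. \<forall>\<^sub>F z in G. z \<in> J j"
proof (rule ccontr)
  assume "\<not> ?thesis"
  then have "\<forall>j\<in>{1..d}. \<forall>\<^sub>F z in G. z \<notin> J j"
    using one_sided_interval_dichotomy[OF G] unfolding iet_int_def by blast
  then have "\<forall>\<^sub>F z in G. \<forall>j\<in>{1..d}. z \<notin> J j"
    by (simp add: eventually_ball_finite)
  with assms(2) have "\<forall>\<^sub>F z in G. False"
    by eventually_elim (auto simp: dom_UN_int)
  moreover have "G \<noteq> bot" using G by (elim disjE) simp_all
  ultimately show False by simp
qed

text \<open>
  A translation carries one-sided neighbourhoods to one-sided neighbourhoods, and these again lie in a
  single interval of the exchange. To the left of a discontinuity \<open>t\<close> is a one-sided limit, in general
  not the displacement of \<open>y\<close>; the right end of the domain is included as a possible \<open>y\<close>.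
\<close>

lemma one_sided_iterate_translation:
  assumes G: "G = at_left y \<or> G = at_right y" and inI: "\<forall>\<^sub>F z in G. z \<in> I"
  shows "\<exists>t. \<forall>\<^sub>F z in G. (f ^^ i) z = z + t"
proof (induction i)
  case 0
  show ?case by (intro exI[of _ 0]) simp
next
  case (Suc i)
  then obtain t where t: "\<forall>\<^sub>F z in G. (f ^^ i) z = z + t" by blast
  let ?G = "filtermap (\<lambda>z. z + t) G"
  have G': "?G = at_left (y + t) \<or> ?G = at_right (y + t)"
    using G filtermap_at_left_shift[of "- t" y] filtermap_at_right_shift[of "- t" y] by auto
  have "\<forall>\<^sub>F z in ?G. z \<in> I"
    unfolding eventually_filtermap using t inI
    by eventually_elim (metis funpow_iet_in_dom)
  from one_sided_in_int[OF G' this] obtain j where j: "j \<in> {1..d}" "\<forall>\<^sub>F z in G. z + t \<in> J j"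
    by (auto simp: eventually_filtermap)
  from t j(2) have "\<forall>\<^sub>F z in G. (f ^^ Suc i) z = z + (t + \<tau> j)"
    by eventually_elim (simp add: iet_eq[OF j(1)])
  then show ?case by blast
qed

end

section \<open>Equidistribution of the orbit of the origin\<close>

locale uniquely_ergodic_interval_exchange = interval_exchange +
  assumes ue: "uniquely_ergodic_iet d \<mu> \<pi>"
begin

abbreviation "orb k \<equiv> (f ^^ k) 0"

lemma orb_in_dom: "orb k \<in> I"
  by (rule funpow_iet_in_dom[OF zero_in_dom])

lemma emeasure_dom: "emeasure lborel I = ennreal L"
  using L_pos by (simp add: dom_eq)

lemma invariant_prob_eq_lebesgue:
  assumes M: "M \<in> invariant_borel_probs I f" and A: "A \<in> sets borel" "A \<subseteq> I"
  shows "emeasure M A = emeasure lborel A / ennreal L"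
proof -
  have I: "I \<in> sets borel" by (simp add: dom_eq)
  have "M = uniform_measure (restrict_space lborel I) I"
    using ue M unfolding uniquely_ergodic_iet_def by blast
  then have "emeasure M A = emeasure (restrict_space lborel I) (I \<inter> A) / emeasure (restrict_space lborel I) I"
    using A I by (simp only:) (subst emeasure_uniform_measure; auto simp: sets_restrict_space)
  then show ?thesis
    using A I by (simp add: emeasure_restrict_space emeasure_dom Int_absorb1)
qed

lemma card_shift_periodic:
  fixes g :: "nat \<Rightarrow> 'b"
  assumes "g q = g 0"
  shows "card {k. k < q \<and> g (Suc k) \<in> A} = card {k. k < q \<and> g k \<in> A}"
proof -
  have c: "card {k. k < q \<and> P k} = (\<Sum>k<q. if P k then 1 else 0)" for P
    by (simp add: sum.If_cases lessThan_def Collect_conj_eq)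
  have "(\<Sum>k<Suc q. if g k \<in> A then 1 else 0::nat) =
      (if g 0 \<in> A then 1 else 0) + (\<Sum>k<q. if g (Suc k) \<in> A then 1 else 0)"
    by (rule sum.lessThan_Suc_shift)
  then show ?thesis using assms by (simp add: c)
qed

text \<open>
  The uniform distribution on a periodic orbit would be an invariant probability measure that
  gives positive mass to a point, unlike Lebesgue measure.
\<close>

lemma not_periodic:
  assumes y: "y \<in> I" and q: "0 < q"
  shows "(f ^^ q) y \<noteq> y"
proof
  assume per: "(f ^^ q) y = y"
  let ?R = "restrict_space borel I" and ?u = "measure_pmf (pmf_of_set {..<q})"
  let ?P = "distr ?u ?R (\<lambda>k. (f ^^ k) y)"
  have o: "(f ^^ k) y \<in> I" for k by (rule funpow_iet_in_dom[OF y])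
  have meas: "(\<lambda>k. (f ^^ k) y) \<in> measurable ?u ?R" "(\<lambda>k. (f ^^ Suc k) y) \<in> measurable ?u ?R"
    using o by (auto simp: space_restrict_space iet_in_dom)
  have ne: "finite {..<q}" "{..<q} \<noteq> {}" using q by auto
  have em: "emeasure (distr ?u ?R x) A = ennreal (card {k. k < q \<and> x k \<in> A} / q)"
    if "x \<in> measurable ?u ?R" "A \<in> sets ?R" for x A
  proof -
    have "{..<q} \<inter> x -` A = {k. k < q \<and> x k \<in> A}" by auto
    then show ?thesis
      using that ne
      by (simp add: emeasure_distr measure_pmf.emeasure_eq_measure measure_pmf_of_set)
  qed
  have "distr ?P ?P f = distr ?P ?R f" by (rule distr_cong) simp_all
  also have "\<dots> = distr ?u ?R (\<lambda>k. (f ^^ Suc k) y)"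
    using distr_distr[OF iet_measurable meas(1)] by (simp add: comp_def)
  also have "\<dots> = ?P"
  proof (rule measure_eqI)
    fix A assume "A \<in> sets (distr ?u ?R (\<lambda>k. (f ^^ Suc k) y))"
    then have A: "A \<in> sets ?R" by simp
    show "emeasure (distr ?u ?R (\<lambda>k. (f ^^ Suc k) y)) A = emeasure ?P A"
      unfolding em[OF meas(1) A] em[OF meas(2) A]
      by (subst card_shift_periodic[of "\<lambda>k. (f ^^ k) y" q]) (simp_all add: per)
  qed simp
  finally have "?P \<in> invariant_borel_probs I f"
    using meas iet_measurable unfolding invariant_borel_probs_def
    by (auto intro!: prob_space.prob_space_distr prob_space_measure_pmf simp: measurable_distr_eq1)
  from invariant_prob_eq_lebesgue[OF this, of "{y}"] y
  have "emeasure ?P {y} = 0" by simp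
  moreover have "emeasure ?P {y} = ennreal (card {k. k < q \<and> (f ^^ k) y \<in> {y}} / q)"
    by (rule em[OF meas(1)]) (use y in \<open>simp add: sets_restrict_space_iff dom_eq\<close>)
  ultimately have "card {k. k < q \<and> (f ^^ k) y \<in> {y}} = 0"
    using q by (simp add: ennreal_eq_0_iff divide_le_0_iff)
  moreover have "0 \<in> {k. k < q \<and> (f ^^ k) y \<in> {y}}" using q by simp
  ultimately show False by (subst (asm) card_0_eq) auto
qed

text \<open>
  Otherwise the earlier of the two equal iterates would be a periodic point.
\<close>

lemma iterates_distinct:
  assumes "y \<in> I" "i \<noteq> i'"
  shows "(f ^^ i) y \<noteq> (f ^^ i') y"
proof -
  have *: "(f ^^ i) y \<noteq> (f ^^ i') y" if "i < i'" for i i'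
  proof -
    have "(f ^^ i') y = (f ^^ (i' - i)) ((f ^^ i) y)"
      using that by (simp flip: funpow_add[THEN fun_cong, unfolded comp_def])
    then show ?thesis
      using not_periodic[of "(f ^^ i) y" "i' - i"] funpow_iet_in_dom[OF assms(1), of i] that by simp
  qed
  show ?thesis using *[of i i'] *[of i' i] assms(2) by (cases "i < i'") auto
qed

text \<open>
  On a short one-sided neighbourhood the iterates of order \<open>i < N\<close> are translations by
  pairwise different amounts \<open>t i\<close>, as there are no periodic points. Once the neighbourhood is
  shorter than all the differences \<open>\<bar>t i - t i'\<bar>\<close>, its iterates are disjoint.
\<close>

lemma one_sided_few_visits:
  assumes G: "G = at_left y \<or> G = at_right y"
  shows "\<exists>U. (\<forall>\<^sub>F z in G. z \<in> U) \<and> (\<forall>n. N * card {k. k \<le> n \<and> orb k \<in> U} \<le> n + 1 + N)"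
proof -
  consider "\<forall>\<^sub>F z in G. z \<notin> I" | "\<forall>\<^sub>F z in G. z \<in> I"
    using one_sided_interval_dichotomy[OF G, of 0 L] by (auto simp: dom_eq)
  then show ?thesis
  proof cases
    case 1
    then show ?thesis using orb_in_dom by (intro exI[of _ "- I"]) auto
  next
    case 2
    obtain t where t: "\<And>i. \<forall>\<^sub>F z in G. (f ^^ i) z = z + t i"
      using one_sided_iterate_translation[OF G 2] by metis
    have G_ne: "G \<noteq> bot" using G by (elim disjE) simp_all
    have t_ne: "t i \<noteq> t i'" if "i \<noteq> i'" for i i'
    proof
      assume "t i = t i'"
      from t[of i] t[of i'] 2 have "\<forall>\<^sub>F z in G. False"
        by eventually_elim (metis \<open>t i = t i'\<close> iterates_distinct[OF _ that])
      with G_ne show False by simp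
    qed
    have "\<forall>\<^sub>F e in at_right 0. i \<noteq> i' \<longrightarrow> e < \<bar>t i - t i'\<bar>" for i i'
    proof (cases "i = i'")
      case False
      with t_ne have "0 < \<bar>t i - t i'\<bar>" by simp
      from order_tendstoD(2)[OF tendsto_ident_at this] show ?thesis
        by (rule eventually_mono) simp
    qed simp
    then have "\<forall>\<^sub>F e in at_right 0. \<forall>i\<in>{..<N}. \<forall>i'\<in>{..<N}. i \<noteq> i' \<longrightarrow> e < \<bar>t i - t i'\<bar>"
      by (simp add: eventually_ball_finite)
    then have "\<forall>\<^sub>F e in at_right 0. 0 < e \<and> (\<forall>i\<in>{..<N}. \<forall>i'\<in>{..<N}. i \<noteq> i' \<longrightarrow> e < \<bar>t i - t i'\<bar>)"
      using eventually_at_right_less[of 0] by eventually_elim auto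
    then obtain e where "0 < e \<and> (\<forall>i\<in>{..<N}. \<forall>i'\<in>{..<N}. i \<noteq> i' \<longrightarrow> e < \<bar>t i - t i'\<bar>)"
      using eventually_happens'[OF trivial_limit_at_right_real] by blast
    then have e: "0 < e" "\<And>i i'. i < N \<Longrightarrow> i' < N \<Longrightarrow> i \<noteq> i' \<Longrightarrow> e < \<bar>t i - t i'\<bar>" by simp_all
    define U where "U = {z. (\<forall>i\<in>{..<N}. (f ^^ i) z = z + t i) \<and> \<bar>z - y\<bar> < e / 2}"
    have "((\<lambda>z. z) \<longlongrightarrow> y) G" using G by auto
    from tendstoD[OF this, of "e / 2"] have "\<forall>\<^sub>F z in G. \<bar>z - y\<bar> < e / 2"
      using e by (simp add: dist_real_def)
    moreover have "\<forall>\<^sub>F z in G. \<forall>i\<in>{..<N}. (f ^^ i) z = z + t i"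
      by (intro eventually_ball_finite ballI t) simp
    ultimately have "\<forall>\<^sub>F z in G. z \<in> U" unfolding U_def by eventually_elim simp
    moreover have "N * card {k. k \<le> n \<and> orb k \<in> U} \<le> n + 1 + N" for n
    proof (rule card_visits_disjoint_iterates)
      fix i i' z z' assume *: "i < N" "i' < N" "i \<noteq> i'" "z \<in> U" "z' \<in> U"
      then have "(f ^^ i) z = z + t i" "(f ^^ i') z' = z' + t i'"
        and "\<bar>z - y\<bar> < e / 2" "\<bar>z' - y\<bar> < e / 2"
        by (simp_all add: U_def)
      with e(2)[OF *(1-3)] show "(f ^^ i) z \<noteq> (f ^^ i') z'" by linarith
    qed
    ultimately show ?thesis by blast
  qed
qed

text \<open>
  A neighbourhood of \<open>y\<close> consists of its two sides and of \<open>y\<close> itself, which is visited at most once.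
\<close>

lemma small_neighbourhood:
  assumes "e > 0"
  shows "\<exists>U. open U \<and> y \<in> U \<and> (\<forall>\<^sub>F n in sequentially. measure (empirical orb n) U \<le> e)"
proof -
  \<comment> \<open>The bound below is \<open>2 / N + 3 / (n + 1)\<close>: the two sides of \<open>y\<close> contribute
    \<open>1 / N + 1 / (n + 1)\<close> each and \<open>y\<close> itself contributes \<open>1 / (n + 1)\<close>.\<close>
  obtain N :: nat where N: "4 / e < N" using reals_Archimedean2 by blast
  have N0: "0 < N" using N assms by (metis divide_pos_pos gr0I of_nat_0 order.asym zero_less_numeral)
  obtain Ul where Ul: "\<forall>\<^sub>F z in at_left y. z \<in> Ul" "\<And>n. N * card {k. k \<le> n \<and> orb k \<in> Ul} \<le> n + 1 + N"
    using one_sided_few_visits[of "at_left y" y N] by blast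
  obtain Ur where Ur: "\<forall>\<^sub>F z in at_right y. z \<in> Ur" "\<And>n. N * card {k. k \<le> n \<and> orb k \<in> Ur} \<le> n + 1 + N"
    using one_sided_few_visits[of "at_right y" y N] by blast
  have Uy: "N * card {k. k \<le> n \<and> orb k \<in> {y}} \<le> N" for n
  proof -
    have "card {k. k \<le> n \<and> orb k \<in> {y}} \<le> Suc 0"
      using iterates_distinct[OF zero_in_dom] by (subst card_le_Suc0_iff_eq) (simp, blast)
    then show ?thesis by simp
  qed
  have "\<forall>\<^sub>F z in at y. z \<in> Ul \<union> Ur"
    unfolding eventually_at_split using Ul(1) Ur(1) by (auto elim: eventually_mono)
  then have "\<forall>\<^sub>F z in nhds y. z \<in> Ul \<union> Ur \<union> {y}"
    unfolding eventually_at_filter by eventually_elim auto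
  then obtain U where U: "open U" "y \<in> U" "U \<subseteq> Ul \<union> Ur \<union> {y}"
    unfolding eventually_nhds by blast
  have bound: "measure (empirical orb n) U \<le> 2 / N + 3 / Suc n" for n
  proof -
    let ?c = "\<lambda>A. card {k. k \<le> n \<and> orb k \<in> A}"
    have "?c U \<le> card ({k. k \<le> n \<and> orb k \<in> Ul} \<union> {k. k \<le> n \<and> orb k \<in> Ur} \<union> {k. k \<le> n \<and> orb k \<in> {y}})"
      using U(3) by (intro card_mono) auto
    also have "\<dots> \<le> ?c Ul + ?c Ur + ?c {y}"
      using card_Un_le[of "{k. k \<le> n \<and> orb k \<in> Ul}" "{k. k \<le> n \<and> orb k \<in> Ur}"]
        card_Un_le[of "{k. k \<le> n \<and> orb k \<in> Ul} \<union> {k. k \<le> n \<and> orb k \<in> Ur}" "{k. k \<le> n \<and> orb k \<in> {y}}"]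
      by linarith
    finally have "N * ?c U \<le> N * (?c Ul + ?c Ur + ?c {y})"
      by (rule mult_le_mono2)
    also have "\<dots> = N * ?c Ul + N * ?c Ur + N * ?c {y}" by (simp only: add_mult_distrib2)
    also have "\<dots> \<le> 2 * Suc n + 3 * N" 
      using add_mono[OF add_mono[OF Ul(2)[of n] Ur(2)[of n]] Uy[of n]] by simp
    finally have "real (N * ?c U) \<le> real (2 * Suc n + 3 * N)" by (simp only: of_nat_le_iff)
    then have "real N * real (?c U) \<le> 2 * real (Suc n) + 3 * real N" by simp
    then have "real N * real (?c U) / (real N * real (Suc n)) \<le>
        (2 * real (Suc n) + 3 * real N) / (real N * real (Suc n))"
      by (intro divide_right_mono) simp_all
    also have "\<dots> = 2 / N + 3 / Suc n"
      using N0 by (simp add: add_divide_distrib del: of_nat_Suc)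
    finally have "real (?c U) / real (Suc n) \<le> 2 / N + 3 / Suc n" using N0 by simp
    then show ?thesis using U(1) by (simp add: measure_empirical)
  qed
  have "(\<lambda>n. 2 / real N + 3 / real (Suc n)) \<longlonglongrightarrow> 2 / real N + 0"
    by (intro tendsto_intros lim_const_over_n[THEN LIMSEQ_Suc])
  moreover have "2 / real N + 0 < e"
    using N N0 assms by (simp add: field_simps)
  ultimately have "\<forall>\<^sub>F n in sequentially. 2 / real N + 3 / real (Suc n) < e"
    by (rule order_tendstoD(2))
  then have "\<forall>\<^sub>F n in sequentially. measure (empirical orb n) U \<le> e"
    by eventually_elim (use bound in \<open>meson less_imp_le order.trans\<close>)
  with U show ?thesis by blast
qed

text \<open>
  A weak limit \<open>M\<close> is a measure on the line. Having no atoms, it is invariant and gives the boundary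
  of the domain mass zero, so no mass is lost at the missing right endpoint; its restriction to
  the domain is then one of the measures to which unique ergodicity applies.
\<close>

lemma weak_limit_is_lebesgue:
  assumes s: "strict_mono s" and M: "real_distribution M"
    and conv: "weak_conv_m (empirical orb \<circ> s) M"
  shows "M = uniform_measure lborel I"
proof -
  interpret M: real_distribution M by fact
  have I: "I \<in> sets borel" by (simp add: dom_eq)
  have N: "real_distribution ((empirical orb \<circ> s) n)" for n by (simp add: real_distribution_empirical)
  have atomless: "measure M {y} = 0" for y
  proof (rule weak_limit_atomless[OF N M conv])
    fix e :: real assume "e > 0"
    from small_neighbourhood[OF this, of y] obtain U where
      "open U" "y \<in> U" "\<forall>\<^sub>F n in sequentially. measure (empirical orb n) U \<le> e" by blast
    then show "\<exists>U. open U \<and> y \<in> U \<and> (\<forall>\<^sub>F n in sequentially. measure ((empirical orb \<circ> s) n) U \<le> e)"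
      using eventually_subseq[OF s] by (auto intro!: exI[of _ U])
  qed
  have step: "orb (Suc k) = iet_total (orb k)" for k by (simp add: iet_total_eq orb_in_dom)
  have inv: "distr M borel iet_total = M"
    by (rule weak_limit_invariant[OF step iet_total_measurable countable_discont_iet_total s M conv atomless])
  have "frontier I = {0} \<union> {L}" using L_pos
    by (auto simp: dom_eq frontier_def)
  moreover have "{0} \<union> {L} \<in> null_sets M"
    using atomless by (intro null_sets.Un) (simp_all add: null_sets_def M.emeasure_eq_measure)
  ultimately have "(\<lambda>n. measure ((empirical orb \<circ> s) n) I) \<longlonglongrightarrow> measure M I"
    by (intro weak_conv_imp_continuity_set_conv[OF N M conv]) (simp_all add: null_sets_def I)
  moreover have "measure ((empirical orb \<circ> s) n) I = 1" for n
    using orb_in_dom by (simp add: measure_empirical I flip: atMost_def)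
  ultimately have MI: "emeasure M I = 1"
    by (simp add: LIMSEQ_const_iff M.emeasure_eq_measure)
  let ?R = "restrict_space M I"
  have sets_R: "sets ?R = sets (restrict_space borel I)"
    by (simp add: sets_restrict_space)
  have "prob_space ?R"
    by (rule prob_spaceI) (simp add: space_restrict_space emeasure_restrict_space I MI)
  moreover have fR: "f \<in> measurable ?R ?R"
    using iet_measurable by (simp add: measurable_cong_sets[OF sets_R sets_R])
  moreover have "distr ?R ?R f = ?R"
  proof (rule measure_eqI)
    fix A assume "A \<in> sets (distr ?R ?R f)"
    then have A: "A \<in> sets borel" "A \<subseteq> I" using I by (simp_all add: sets_restrict_space_iff)
    have fA: "f -` A \<inter> I \<in> sets borel"
      using measurable_sets[OF iet_measurable, of A] A I
      by (simp add: sets_restrict_space_iff space_restrict_space)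
    have "emeasure (distr ?R ?R f) A = emeasure M (f -` A \<inter> I)"
      using A I fA by (subst emeasure_distr[OF fR])
        (simp_all add: sets_restrict_space_iff space_restrict_space emeasure_restrict_space)
    also have "f -` A \<inter> I = (iet_total -` A) \<inter> I" by (auto simp: iet_total_eq)
    also have "emeasure M \<dots> = emeasure M (iet_total -` A)"
    proof -
      have "AE x in M. x \<in> I" using MI I by (simp add: M.AE_in_set_eq_1 M.emeasure_eq_measure)
      then show ?thesis
        using A I by (intro emeasure_eq_AE) (auto intro: measurable_sets_borel[OF iet_total_measurable])
    qed
    also have "\<dots> = emeasure (distr M borel iet_total) A" using A by (subst emeasure_distr) auto
    also have "\<dots> = emeasure ?R A" using A I by (simp add: inv emeasure_restrict_space)
    finally show "emeasure (distr ?R ?R f) A = emeasure ?R A" .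
  qed simp
  ultimately have inR: "?R \<in> invariant_borel_probs I f"
    using sets_R by (simp add: invariant_borel_probs_def)
  show ?thesis
  proof (rule measure_eqI)
    fix A assume "A \<in> sets M"
    then have A: "A \<in> sets borel" by simp
    have "AE x in M. x \<in> I" using MI I by (simp add: M.AE_in_set_eq_1 M.emeasure_eq_measure)
    then have "emeasure M A = emeasure M (I \<inter> A)"
      using A I by (intro emeasure_eq_AE) auto
    also have "\<dots> = emeasure ?R (I \<inter> A)" using A I by (simp add: emeasure_restrict_space)
    also have "\<dots> = emeasure lborel (I \<inter> A) / ennreal L"
      using A I by (intro invariant_prob_eq_lebesgue[OF inR]) auto
    also have "\<dots> = emeasure (uniform_measure lborel I) A"
      using A I by (simp add: emeasure_dom)
    finally show "emeasure M A = emeasure (uniform_measure lborel I) A" .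
  qed simp
qed

text \<open>
  The empirical measures are tight and all their weak limits coincide, so they converge weakly to
  normalised Lebesgue measure; intervals have boundaries of measure zero.
\<close>

theorem orbit_equidistributed:
  assumes "0 \<le> a" "a \<le> b" "b \<le> L"
  shows "(\<lambda>n. real (card {k. k \<le> n \<and> orb k \<in> {a..<b}}) / real (Suc n)) \<longlonglongrightarrow> (b - a) / L"
proof -
  let ?U = "uniform_measure lborel I"
  have I: "I \<in> sets borel" by (simp add: dom_eq)
  have U: "real_distribution ?U"
    using L_pos unfolding real_distribution_def real_distribution_axioms_def
    by (auto intro!: prob_space_uniform_measure simp: emeasure_dom)
  interpret U: real_distribution ?U by (rule U)
  have "orb k \<in> {0..L}" for k using orb_in_dom[of k] by (simp add: dom_eq)
  then have "tight (empirical orb)" by (rule tight_empirical)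
  then have "weak_conv_m (empirical orb) ?U"
  proof (rule tight_subseq_weak_converge[OF real_distribution_empirical U])
    fix s \<nu> assume "strict_mono s" "real_distribution \<nu>" "weak_conv_m (empirical orb \<circ> s) \<nu>"
    then show "weak_conv_m (empirical orb \<circ> s) ?U" using weak_limit_is_lebesgue by metis
  qed
  moreover have "emeasure ?U (frontier {a..<b}) = 0"
  proof -
    have "closure {a..<b} \<subseteq> {a..b}" by (rule closure_minimal) auto
    then have "frontier {a..<b} \<subseteq> {a, b}" by (auto simp: frontier_def interior_atLeastLessThan)
    then have "countable (I \<inter> frontier {a..<b})"
      using countable_subset[of "I \<inter> frontier {a..<b}" "{a, b}"] by blast
    then have "emeasure lborel (I \<inter> frontier {a..<b}) = 0"
      by (rule emeasure_lborel_countable)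
    then show ?thesis using I by (subst emeasure_uniform_measure) auto
  qed
  ultimately have "(\<lambda>n. measure (empirical orb n) {a..<b}) \<longlonglongrightarrow> measure ?U {a..<b}"
    by (intro weak_conv_imp_continuity_set_conv real_distribution_empirical U) auto
  moreover have "measure ?U {a..<b} = (b - a) / L"
  proof -
    have "I \<inter> {a..<b} = {a..<b}" using assms by (auto simp: dom_eq)
    then show ?thesis using assms L_pos I
      by (simp add: measure_def emeasure_dom divide_ennreal)
  qed
  ultimately show ?thesis by (simp add: measure_empirical)
qed

end

section \<open>Unrolling the recurrence along an orbit\<close>

text \<open>
  The elements of \<open>V\<close> up to \<open>n\<close> form an initial segment of its increasing enumeration.
\<close>

lemma sum_enumerate_upto:
  fixes V :: "nat set" and g :: "nat \<Rightarrow> 'a::comm_monoid_add"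
  assumes V: "infinite V"
  shows "(\<Sum>m<card {k \<in> V. k \<le> n}. g (enumerate V m)) = (\<Sum>k | k \<in> V \<and> k \<le> n. g k)"
proof -
  define a where "a = (LEAST m. n < enumerate V m)"
  have "\<exists>m. n < enumerate V m"
    using le_enumerate[OF V, of "Suc n"] Suc_le_lessD by blast
  then have "n < enumerate V a" unfolding a_def by (rule LeastI_ex)
  moreover have "enumerate V m \<le> n" if "m < a" for m
    using not_less_Least[OF that[unfolded a_def]] by simp
  ultimately have a: "m < a \<longleftrightarrow> enumerate V m \<le> n" for m
    by (meson V enumerate_mono_le_iff leD leI order.strict_trans2)
  have "bij_betw (enumerate V) {..<a} {k \<in> V. k \<le> n}"
    unfolding bij_betw_def
  proof
    show "inj_on (enumerate V) {..<a}" using inj_enumerate[OF V] by (rule inj_on_subset) simp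
    show "enumerate V ` {..<a} = {k \<in> V. k \<le> n}"
    proof (intro equalityI subsetI)
      fix k assume k: "k \<in> {k \<in> V. k \<le> n}"
      then obtain m where "enumerate V m = k" using enumerate_Ex[OF V] by blast
      with k a[of m] show "k \<in> enumerate V ` {..<a}" by auto
    qed (use a enumerate_in_set[OF V] in auto)
  qed
  then show ?thesis
    using sum.reindex_bij_betw[of "enumerate V" "{..<a}"] bij_betw_same_card by fastforce
qed

lemma exp_neg_ii_rmod: "exp (- \<i> * of_real (a rmod (2 * pi))) = exp (- \<i> * of_real a)"
  unfolding exp_eq
  by (rule exI[of _ "\<lfloor>a / (2 * pi)\<rfloor>"]) (simp add: rmod_def algebra_simps)

text \<open>
  Multiplying \<open>z n - z 0\<close> by the inverse of the accumulated rotation makes the rotation in each step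
  cancel; the increment from \<open>n\<close> to \<open>n + 1\<close> is the defect by which step \<open>n\<close> fails to fix \<open>z 0\<close>, rotated
  back by \<open>n + 1\<close> angles.
\<close>

lemma rotated_recurrence_telescope:
  fixes z b :: "nat \<Rightarrow> complex" and \<phi> :: "nat \<Rightarrow> real"
  assumes z: "\<And>k. z (Suc k) = exp (\<i> * of_real (\<phi> k)) * z k + b k"
  shows "(z n - z 0) * exp (- \<i> * of_real (\<Sum>i<n. \<phi> i)) =
    (\<Sum>k<n. exp (- \<i> * of_real (\<Sum>i<Suc k. \<phi> i)) * (b k - z 0 * (1 - exp (\<i> * of_real (\<phi> k)))))"
proof (induction n)
  case (Suc n)
  let ?E = "\<lambda>n. exp (- \<i> * of_real (\<Sum>i<n. \<phi> i))" and ?u = "exp (\<i> * of_real (\<phi> n))"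
  have "?E n = ?u * ?E (Suc n)"
    unfolding exp_add[symmetric] by (simp add: algebra_simps)
  then have "(z (Suc n) - z 0) * ?E (Suc n) =
      (z n - z 0) * ?E n + ?E (Suc n) * (b n - z 0 * (1 - ?u))"
    unfolding z by (simp only:) (simp add: algebra_simps)
  then show ?case by (simp only: Suc.IH sum.lessThan_Suc)
qed simp

context uniquely_ergodic_interval_exchange
begin

abbreviation "p \<equiv> closest_ret d \<mu> \<pi>"

lemma infinite_visits:
  assumes "0 \<le> a" "a < b" "b \<le> L"
  shows "infinite {k. orb k \<in> {a..<b}}"
proof
  assume fin: "finite {k. orb k \<in> {a..<b}}"
  let ?c = "\<lambda>n. card {k. k \<le> n \<and> orb k \<in> {a..<b}}"
  let ?C = "card {k. orb k \<in> {a..<b}}"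
  have "(\<lambda>n. real (?c n) / real (Suc n)) \<longlonglongrightarrow> 0"
  proof (rule Lim_null_comparison)
    have "?c n \<le> ?C" for n by (intro card_mono fin) auto
    then show "\<forall>\<^sub>F n in sequentially. norm (real (?c n) / real (Suc n)) \<le> real ?C / real (Suc n)"
      by (intro always_eventually allI) (simp add: divide_right_mono)
    show "(\<lambda>n. real ?C / real (Suc n)) \<longlonglongrightarrow> 0"
      by (rule lim_const_over_n[THEN LIMSEQ_Suc])
  qed
  moreover have "(\<lambda>n. real (?c n) / real (Suc n)) \<longlonglongrightarrow> (b - a) / L"
    using assms by (intro orbit_equidistributed) simp_all
  ultimately have "(b - a) / L = 0" by (rule LIMSEQ_unique[rotated])
  then show False using assms L_pos by simp
qed

lemma int_bounds:
  assumes "j \<in> {1..d}"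
  shows "0 \<le> iet_pt \<mu> (j - 1)" "iet_pt \<mu> (j - 1) < iet_pt \<mu> j" "iet_pt \<mu> j \<le> L"
  using assms iet_pt_mono[of 0 "j - 1"] iet_pt_mono[of j d] iet_pt_diff[of j] pos[of j] by auto

lemma infinite_visits_int: "j \<in> {1..d} \<Longrightarrow> infinite {k. orb k \<in> J j}"
  unfolding iet_int_def by (intro infinite_visits int_bounds)

lemma visits_frequency:
  assumes "j \<in> {1..d}"
  shows "(\<lambda>n. real (visits d \<mu> \<pi> j n) / real (Suc n)) \<longlonglongrightarrow> \<mu> j / L"
  using orbit_equidistributed[of "iet_pt \<mu> (j - 1)" "iet_pt \<mu> j"] int_bounds[OF assms] iet_pt_diff[OF assms]
  by (simp add: visits_def iet_int_def)

text \<open>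
  Iterating the first return map from the first visit passes through all visits in order. The
  entry point is thereby traded for the origin: the \<open>m\<close>-th visit counted from it is the \<open>m\<close>-th
  visit of the orbit of the origin, counted from \<open>0\<close>.
\<close>

lemma visit_time_eq_enumerate:
  fixes j :: nat
  defines "V \<equiv> {k. orb k \<in> J j}"
  assumes j: "j \<in> {1..d}"
  shows "(ret_map d \<mu> \<pi> j ^^ m) (entry_pt d \<mu> \<pi> j) = orb (enumerate V m)"
    and "entry_time d \<mu> \<pi> j + ret_time_sum d \<mu> \<pi> j m (entry_pt d \<mu> \<pi> j) = enumerate V m"
proof -
  have V: "infinite V" unfolding V_def by (rule infinite_visits_int[OF j])
  have add: "(f ^^ k) (orb n) = orb (n + k)" for k n
    by (metis add.commute comp_apply funpow_add)
  have ret: "ret_time d \<mu> \<pi> j (orb (enumerate V m)) = enumerate V (Suc m) - enumerate V m" for m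
    unfolding ret_time_def add
  proof (rule Least_equality)
    show "1 \<le> enumerate V (Suc m) - enumerate V m \<and>
        orb (enumerate V m + (enumerate V (Suc m) - enumerate V m)) \<in> J j"
      using enumerate_step[OF V, of m] enumerate_in_set[OF V, of "Suc m"] by (simp add: V_def)
  next
    fix k assume k: "1 \<le> k \<and> orb (enumerate V m + k) \<in> J j"
    then have "enumerate V (Suc m) \<le> enumerate V m + k"
      unfolding enumerate_Suc''[OF V] by (intro Least_le) (auto simp: V_def)
    then show "enumerate V (Suc m) - enumerate V m \<le> k" by simp
  qed
  have entry: "entry_time d \<mu> \<pi> j = enumerate V 0"
    by (simp add: entry_time_def enumerate_0 V_def)
  show map: "(ret_map d \<mu> \<pi> j ^^ m) (entry_pt d \<mu> \<pi> j) = orb (enumerate V m)" for m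
  proof (induction m)
    case 0
    show ?case by (simp add: entry_pt_def entry del: enumerate_0)
  next
    case (Suc m)
    have "ret_map d \<mu> \<pi> j (orb (enumerate V m)) = orb (enumerate V (Suc m))"
      using enumerate_step[OF V, of m] by (simp add: ret_map_def ret add del: enumerate_Suc)
    then show ?case using Suc by (simp del: enumerate_Suc)
  qed
  show "entry_time d \<mu> \<pi> j + ret_time_sum d \<mu> \<pi> j m (entry_pt d \<mu> \<pi> j) = enumerate V m"
  proof (induction m)
    case 0
    show ?case by (simp add: entry ret_time_sum_def del: enumerate_0)
  next
    case (Suc m)
    then show ?case
      using enumerate_step[OF V, of m] by (simp add: ret_time_sum_def map ret del: enumerate_Suc)
  qed
qed

text \<open>
  The two cocycle values in the definition of the angle are reduced modulo \<open>2\<pi>\<close> separately, which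
  the exponential does not see; together they run over the orbit of the origin up to and including
  the time of the visit, whence the \<open>Suc k\<close>.
\<close>

lemma visit_exp_sum_eq:
  assumes j: "j \<in> {1..d}"
  shows "visit_exp_sum d \<mu> \<pi> \<theta> j n =
    (\<Sum>k | k \<le> n \<and> orb k \<in> J j. exp (- \<i> * of_real (\<Sum>i<Suc k. \<theta> (ix (orb i)))))"
proof -
  define V where "V = {k. orb k \<in> J j}"
  define S where "S n x = (\<Sum>i<n. \<theta> (ix ((f ^^ i) x)))" for n x
  have V: "infinite V" unfolding V_def by (rule infinite_visits_int[OF j])
  have S_add: "S (a + b) x = S a x + S b ((f ^^ a) x)" for a b x
  proof (induction b)
    case (Suc b)
    have "(f ^^ (a + b)) x = (f ^^ b) ((f ^^ a) x)" by (metis add.commute comp_apply funpow_add)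
    with Suc show ?case by (simp add: S_def)
  qed (simp add: S_def)
  have "exp (- \<i> * of_real (visit_angle d \<mu> \<pi> \<theta> j m)) = exp (- \<i> * of_real (S (Suc (enumerate V m)) 0))" for m
  proof -
    let ?t = "entry_time d \<mu> \<pi> j" and ?x = "entry_pt d \<mu> \<pi> j"
    let ?r = "ret_time_sum d \<mu> \<pi> j m ?x + 1"
    have "exp (- \<i> * of_real (visit_angle d \<mu> \<pi> \<theta> j m)) =
        exp (- \<i> * of_real (S ?t 0 rmod (2 * pi))) * exp (- \<i> * of_real (S ?r ?x rmod (2 * pi)))"
      unfolding visit_angle_def cocycle_def S_def exp_add[symmetric] by (simp only: of_real_add distrib_left)
    also have "\<dots> = exp (- \<i> * of_real (S ?t 0 + S ?r ?x))"
      unfolding exp_neg_ii_rmod exp_add[symmetric] by (simp only: of_real_add distrib_left)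
    also have "S ?t 0 + S ?r ?x = S (?t + ?r) 0" by (simp only: S_add entry_pt_def)
    also have "?t + ?r = Suc (enumerate V m)"
      using visit_time_eq_enumerate(2)[OF j, of m] by (simp add: V_def)
    finally show ?thesis .
  qed
  then have "visit_exp_sum d \<mu> \<pi> \<theta> j n =
      (\<Sum>m<card {k \<in> V. k \<le> n}. exp (- \<i> * of_real (S (Suc (enumerate V m)) 0)))"
    by (simp add: visit_exp_sum_def visits_def V_def conj_commute)
  also have "\<dots> = (\<Sum>k | k \<in> V \<and> k \<le> n. exp (- \<i> * of_real (S (Suc k) 0)))"
    by (rule sum_enumerate_upto[OF V])
  finally show ?thesis by (simp add: V_def S_def conj_commute)
qed

text \<open>
  Since the orbit never returns to the origin and visits every interval \<open>[0, \<epsilon>)\<close> infinitely often,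
  the minima that define the closest returns are attained.
\<close>

lemma closest_ret_1: "1 \<le> p 1" "orb (p 1) \<in> J 1"
proof -
  have "infinite {k. orb k \<in> J 1}" using infinite_visits_int[of 1] d_ge_2 by simp
  then obtain k where "1 \<le> k" "orb k \<in> J 1"
    unfolding infinite_nat_iff_unbounded_le by blast
  then have "1 \<le> p 1 \<and> orb (p 1) \<in> J 1"
    using LeastI[of "\<lambda>k. 1 \<le> k \<and> orb k \<in> J 1" k] by simp
  then show "1 \<le> p 1" "orb (p 1) \<in> J 1" by simp_all
qed

lemma closest_ret_Suc:
  assumes "1 \<le> n" "1 \<le> p n"
  shows "p n < p (Suc n)" "orb (p (Suc n)) < orb (p n)"
proof -
  have "orb (p n) \<noteq> 0" using not_periodic[OF zero_in_dom, of "p n"] assms by simp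
  then have "0 < orb (p n)" "orb (p n) \<le> L" using orb_in_dom[of "p n"] by (simp_all add: dom_eq)
  then have "infinite {k. orb k \<in> {0..<orb (p n)}}" by (intro infinite_visits) simp_all
  then obtain k where "p n < k" "orb k < orb (p n)"
    unfolding infinite_nat_iff_unbounded by auto
  moreover have "p (Suc n) = (LEAST k. p n < k \<and> orb k < orb (p n))"
    using assms(1) by (cases n) simp_all
  ultimately have "p n < p (Suc n) \<and> orb (p (Suc n)) < orb (p n)"
    using LeastI[of "\<lambda>k. p n < k \<and> orb k < orb (p n)" k] by simp
  then show "p n < p (Suc n)" "orb (p (Suc n)) < orb (p n)" by simp_all
qed

lemma closest_ret_bounds: "Suc n \<le> p (Suc n) \<and> orb (p (Suc n)) \<le> orb (p 1)"
proof (induction n)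
  case 0
  then show ?case using closest_ret_1 by simp
next
  case (Suc n)
  then have "p (Suc n) < p (Suc (Suc n))" "orb (p (Suc (Suc n))) < orb (p (Suc n))"
    by (intro closest_ret_Suc; simp)+
  with Suc show ?case by linarith
qed

lemma closest_ret_at_top: "filterlim p sequentially sequentially"
proof -
  have "n \<le> p n" for n using closest_ret_bounds[of "n - 1"] by (cases n) auto
  then show ?thesis by (intro filterlim_at_top_mono[OF filterlim_ident]) auto
qed

end

section \<open>The linear relation\<close>

theorem theorem4p1:
  fixes d :: nat and \<mu> :: "nat \<Rightarrow> real" and \<pi> :: "nat \<Rightarrow> nat"
    and X :: "complex set" and Xs :: "nat \<Rightarrow> complex set"
    and \<theta> :: "nat \<Rightarrow> real" and l :: "nat \<Rightarrow> complex" and T :: "complex \<Rightarrow> complex"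
    and h :: "real \<Rightarrow> complex" and \<xi> :: "nat \<Rightarrow> complex"
  assumes "iet_data d \<mu> \<pi>"
    and "uniquely_ergodic_iet d \<mu> \<pi>"
    and "pwi d X Xs \<theta> l T"
    and "pw_cont_embedding d \<mu> \<pi> X Xs T h"
    and "\<And>j. j \<in> {1..d} \<Longrightarrow>
      (\<lambda>n. 1 / of_nat (visits d \<mu> \<pi> j (closest_ret d \<mu> \<pi> n)) *
            visit_exp_sum d \<mu> \<pi> \<theta> j (closest_ret d \<mu> \<pi> n)) \<longlonglongrightarrow> \<xi> j"
  shows "(\<Sum>j=1..d. (l j - h 0 * (1 - exp (\<i> * of_real (\<theta> j)))) * \<xi> j * of_real (\<mu> j)) = 0"
proof -
  interpret uniquely_ergodic_interval_exchange d \<mu> \<pi>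
    using assms(1,2) by unfold_locales
  define A where "A j = l j - h 0 * (1 - exp (\<i> * of_real (\<theta> j)))" for j
  define E where "E n = exp (- \<i> * of_real (\<Sum>i<n. \<theta> (ix (orb i))))" for n
  let ?e = "visit_exp_sum d \<mu> \<pi> \<theta>" and ?v = "visits d \<mu> \<pi>"
  have h_step: "h (f x) = exp (\<i> * of_real (\<theta> (ix x))) * h x + l (ix x)" if x: "x \<in> I" for x
  proof -
    have "h x \<in> Xs (ix x)"
      using assms(4) idx_in[OF x] in_int_idx[OF x] unfolding pw_cont_embedding_def by blast
    then have "T (h x) = exp (\<i> * of_real (\<theta> (ix x))) * h x + l (ix x)"
      using assms(3) idx_in[OF x] unfolding pwi_def by blast
    then show ?thesis using assms(4) x by (simp add: pw_cont_embedding_def)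
  qed
  have tel: "(\<Sum>j=1..d. A j * ?e j n) = (h (orb (Suc n)) - h 0) * E (Suc n)" for n
  proof -
    have "(\<Sum>j=1..d. A j * ?e j n) =
        (\<Sum>j=1..d. \<Sum>k\<le>n. if orb k \<in> J j then E (Suc k) * A j else 0)"
      by (intro sum.cong)
        (simp_all add: visit_exp_sum_eq E_def sum_distrib_left sum_distrib_right mult.commute flip: sum.inter_filter)
    also have "\<dots> = (\<Sum>k\<le>n. \<Sum>j=1..d. if orb k \<in> J j then E (Suc k) * A j else 0)"
      by (rule sum.swap)
    also have "\<dots> = (\<Sum>k\<le>n. E (Suc k) * A (ix (orb k)))"
    proof (rule sum.cong[OF refl])
      fix k
      have "orb k \<in> J j \<longleftrightarrow> j = ix (orb k)" if "j \<in> {1..d}" for j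
        using idx_eq[OF that, of "orb k"] in_int_idx[OF orb_in_dom, of k] by blast
      then have "(\<Sum>j=1..d. if orb k \<in> J j then E (Suc k) * A j else 0) =
          (\<Sum>j\<in>{1..d}. if j = ix (orb k) then E (Suc k) * A j else 0)"
        by (intro sum.cong) simp_all
      also have "\<dots> = E (Suc k) * A (ix (orb k))"
        using idx_in[OF orb_in_dom, of k] by simp
      finally show "(\<Sum>j=1..d. if orb k \<in> J j then E (Suc k) * A j else 0) = E (Suc k) * A (ix (orb k))" .
    qed
    also have "\<dots> = (h (orb (Suc n)) - h 0) * E (Suc n)"
      using rotated_recurrence_telescope[of "\<lambda>k. h (orb k)" "\<lambda>k. \<theta> (ix (orb k))" "\<lambda>k. l (ix (orb k))" "Suc n"]
        h_step[OF orb_in_dom]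
      by (simp add: E_def A_def lessThan_Suc_atMost)
    finally show ?thesis .
  qed
  have one: "1 \<in> {1..d}" using d_ge_2 by simp
  \<comment> \<open>At closest returns the orbit lies in the compact interval \<open>[0, orb (p 1)]\<close> inside the first interval
    of the exchange; one more step is the application of a single isometry.\<close>
  obtain B where B: "\<And>n. norm (h (orb (Suc (p (Suc n)))) - h 0) \<le> B"
  proof -
    have "continuous_on (J 1) h"
      using assms(4) one unfolding pw_cont_embedding_def homeomorphism_def by blast
    moreover have J1: "{0..orb (p 1)} \<subseteq> J 1" using closest_ret_1(2) by (auto simp: iet_int_def)
    ultimately have "compact (h ` {0..orb (p 1)})"
      by (intro compact_continuous_image) (auto intro: continuous_on_subset)
    then have "bounded (h ` {0..orb (p 1)})" by (rule compact_imp_bounded)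
    then obtain C where "\<forall>z\<in>h ` {0..orb (p 1)}. norm z \<le> C" unfolding bounded_iff by blast
    then have C: "norm (h x) \<le> C" if "x \<in> {0..orb (p 1)}" for x using that by (rule bspec[OF _ imageI])
    have "norm (h (orb (Suc (p (Suc n)))) - h 0) \<le> C + norm (l 1) + norm (h 0)" for n
    proof -
      let ?x = "orb (p (Suc n))"
      have x: "?x \<in> {0..orb (p 1)}"
        using closest_ret_bounds[of n] orb_in_dom[of "p (Suc n)"] by (simp add: dom_eq)
      then have "ix ?x = 1" using J1 by (intro idx_eq one) blast
      then have "h (orb (Suc (p (Suc n)))) = exp (\<i> * of_real (\<theta> 1)) * h ?x + l 1"
        using h_step[OF orb_in_dom, of "p (Suc n)"] by simp
      then have "norm (h (orb (Suc (p (Suc n))))) \<le> norm (h ?x) + norm (l 1)"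
        using norm_triangle_ineq[of "exp (\<i> * of_real (\<theta> 1)) * h ?x" "l 1"] by (simp add: norm_mult)
      then show ?thesis
        using C[OF x] norm_triangle_ineq4[of "h (orb (Suc (p (Suc n))))" "h 0"] by linarith
    qed
    then show ?thesis by (rule that)
  qed
  \<comment> \<open>The sequence \<open>p\<close> is shifted by one because its value at \<open>0\<close> is not a closest return.\<close>
  let ?q = "\<lambda>n. p (Suc n)"
  have q: "filterlim ?q sequentially sequentially"
    using closest_ret_at_top by (simp add: filterlim_sequentially_Suc)
  have lim1: "(\<lambda>n. (\<Sum>j=1..d. A j * ?e j (?q n)) / of_nat (Suc (?q n))) \<longlonglongrightarrow> 0"
  proof (rule Lim_null_comparison)
    have "(\<lambda>n. B / real (Suc n)) \<longlonglongrightarrow> 0" by (rule lim_const_over_n[THEN LIMSEQ_Suc])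
    then show "(\<lambda>n. B / real (Suc (?q n))) \<longlonglongrightarrow> 0" by (rule filterlim_compose[OF _ q])
    have "norm (E n) = 1" for n by (simp add: E_def)
    then show "\<forall>\<^sub>F n in sequentially. norm ((\<Sum>j=1..d. A j * ?e j (?q n)) / of_nat (Suc (?q n)))
        \<le> B / real (Suc (?q n))"
      using B unfolding tel by (intro always_eventually allI)
        (simp add: norm_divide norm_mult divide_right_mono del: of_nat_Suc funpow.simps)
  qed
  have "(\<lambda>n. \<Sum>j=1..d. A j * ((1 / of_nat (?v j (?q n)) * ?e j (?q n)) *
      of_real (real (?v j (?q n)) / real (Suc (?q n))))) \<longlonglongrightarrow>
      (\<Sum>j=1..d. A j * (\<xi> j * of_real (\<mu> j / L)))"
  proof (intro tendsto_sum tendsto_mult tendsto_const tendsto_of_real)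
    fix j assume j: "j \<in> {1..d}"
    show "(\<lambda>n. 1 / of_nat (?v j (?q n)) * ?e j (?q n)) \<longlonglongrightarrow> \<xi> j"
      using assms(5)[OF j] by (rule LIMSEQ_Suc)
    show "(\<lambda>n. real (?v j (?q n)) / real (Suc (?q n))) \<longlonglongrightarrow> \<mu> j / L"
      using visits_frequency[OF j] q by (rule filterlim_compose)
  qed
  also have "(\<lambda>n. \<Sum>j=1..d. A j * ((1 / of_nat (?v j (?q n)) * ?e j (?q n)) *
      of_real (real (?v j (?q n)) / real (Suc (?q n))))) =
      (\<lambda>n. (\<Sum>j=1..d. A j * ?e j (?q n)) / of_nat (Suc (?q n)))"
  proof
    fix n
    \<comment> \<open>Before the first visit both sides vanish, as the exponential sum is empty.\<close>
    have "(1 / of_nat (?v j m) * ?e j m) * of_real (real (?v j m) / real (Suc m)) = ?e j m / of_nat (Suc m)" for j m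
      by (cases "?v j m = 0") (simp_all add: visit_exp_sum_def del: of_nat_Suc)
    then show "(\<Sum>j=1..d. A j * ((1 / of_nat (?v j (?q n)) * ?e j (?q n)) *
      of_real (real (?v j (?q n)) / real (Suc (?q n))))) = (\<Sum>j=1..d. A j * ?e j (?q n)) / of_nat (Suc (?q n))"
      by (simp only: sum_divide_distrib times_divide_eq_right)
  qed
  finally have "(\<Sum>j=1..d. A j * (\<xi> j * of_real (\<mu> j / L))) = 0"
    using lim1 by (rule LIMSEQ_unique)
  then have "(\<Sum>j=1..d. A j * \<xi> j * of_real (\<mu> j)) / of_real L = 0"
    by (simp add: sum_divide_distrib mult.assoc)
  then show ?thesis using L_pos by (simp add: A_def)
qed

end
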